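(* Assume that $\det(R+B^H\overline{H}B)\neq 0$, that $\mathbb{T}\neq\emptyset$, and that $\mathcal{R}_{\leq}\cap\mathbb{P}\neq\emptyset$. Then the conjugate discrete-time algebraic Riccati equation (CDARE) $X=\mathcal{R}(X)$ and its associated discrete-time algebraic Riccati equation (DARE) $X=\widehat{\mathcal{R}}(X)$ have the same maximal solution $X_M$; that is, both equations have a maximal solution, and the two maximal solutions coincide.
   Context: Notation. $M^H$ is the conjugate transpose and $\overline{M}$ the entrywise complex conjugate of a matrix $M$; $I$ is an identity matrix of suitable size; $M\oplus N$ is the block diagonal matrix with blocks $M,N$; $\mathbb{H}_\ell$ is the set of $\ell\times\ell$ complex Hermitian matrices. For Hermitian matrices, $M>0$ ($M\ge 0$) means positive definite (positive semidefinite), and $M\geq N$ means $M-N\geq 0$. $\rho$ is the spectral radius. Data. $A\in\mathbb{C}^{n\times n}$, $B\in\mathbb{C}^{n\times m}$, $R\in\mathbb{H}_m$ nonsingular, $H\in\mathbb{H}_n$, $G:=BR^{-1}B^H$. For $X\in\mathbb{H}_n$ put $R_X:=R+B^H\overline{X}B$ (so $R_H=R+B^H\overline{H}B$), and $\mathrm{dom}(\mathcal{R}):=\{X\in\mathbb{H}_n : \det R_X\neq 0\}$. For $X\in\mathrm{dom}(\mathcal{R})$ let $$\mathcal{R}(X):=A^H\overline{X}A-A^H\overline{X}B\,R_X^{-1}B^H\overline{X}A+H=A^H\overline{X}(I+G\overline{X})^{-1}A+H,$$ $F_X:=R_X^{-1}B^H\overline{X}A$, $T_X:=A-BF_X$,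 $\widehat{T}_X:=\overline{T_X}\,T_X$. Sets: $\mathcal{R}_{\leq}:=\{X\in\mathrm{dom}(\mathcal{R}) : X\leq\mathcal{R}(X)\}$, $\mathbb{P}:=\{X\in\mathrm{dom}(\mathcal{R}) : R_X>0\}$, $\mathbb{T}:=\{X\in\mathrm{dom}(\mathcal{R}) : \rho(\widehat{T}_X)<1\}$. Transformed DARE (defined when $\det R_H\neq0$): $\widehat{A}:=\overline{A}A-\overline{A}B R_H^{-1}B^H\overline{H}A$, $\widehat{B}:=[\,\overline{B}\ \ \overline{A}B\,]\in\mathbb{C}^{n\times 2m}$, $\widehat{R}:=\overline{R}\oplus R_H$, $\widehat{G}:=\widehat{B}\widehat{R}^{-1}\widehat{B}^H$, $\widehat{H}:=H+A^H\overline{H}(I+G\overline{H})^{-1}A$, $\widehat{R}_X:=\widehat{R}+\widehat{B}^HX\widehat{B}$, $\mathrm{dom}(\widehat{\mathcal{R}}):=\{X\in\mathbb{H}_n:\det\widehat{R}_X\neq0\}$, and for $X\in\mathrm{dom}(\widehat{\mathcal{R}})$ $$\widehat{\mathcal{R}}(X):=\widehat{A}^HX\widehat{A}-\widehat{A}^HX\widehat{B}\,\widehat{R}_X^{-1}\widehat{B}^HX\widehat{A}+\widehat{H}=\widehat{A}^HX(I+\widehat{G}X)^{-1}\widehat{A}+\widehat{H}.$$ $\widehat{\mathbb{P}}:=\{X\in\mathrm{dom}(\widehat{\mathcal{R}}):\widehat{R}_X>0\}$. Convention on solutions. The solutions of the CDARE considered are the Hermitian $X$ with $X=\mathcal{R}(X)$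 and $R_X>0$ (i.e. $X\in\mathbb{P}$); the solutions of the DARE considered are the Hermitian $X$ with $X=\widehat{\mathcal{R}}(X)$ and $\widehat{R}_X>0$ (i.e. $X\in\widehat{\mathbb{P}}$). A maximal solution is a solution $X_M$ with $X_M\geq X$ for every solution $X$; it is unique if it exists. *)

theory Defs
  imports "HOL-Analysis.Analysis"
begin

text \<open>
  A matrix with n rows and m columns is an element of \<open>complex^'m^'n\<close>; since index types
  are nonempty, n and m are at least 1.
\<close>

definition conj_mat :: "complex^'m^'n \<Rightarrow> complex^'m^'n" where
  "conj_mat M = map_matrix cnj M"

definition conj_transpose :: "complex^'m^'n \<Rightarrow> complex^'n^'m" where
  "conj_transpose M = transpose (conj_mat M)"

definition hermitian :: "complex^'n^'n \<Rightarrow> bool" where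
  "hermitian M \<longleftrightarrow> conj_transpose M = M"

definition quad_form :: "complex^'n^'n \<Rightarrow> complex^'n \<Rightarrow> complex" where
  "quad_form M x = (\<Sum>i\<in>UNIV. cnj (x $ i) * (M *v x) $ i)"

text \<open>For Hermitian \<open>M\<close> the quadratic form is real-valued, so taking its real part loses nothing.\<close>

definition pos_def :: "complex^'n^'n \<Rightarrow> bool" where
  "pos_def M \<longleftrightarrow> hermitian M \<and> (\<forall>x. x \<noteq> 0 \<longrightarrow> Re (quad_form M x) > 0)"

definition pos_semidef :: "complex^'n^'n \<Rightarrow> bool" where
  "pos_semidef M \<longleftrightarrow> hermitian M \<and> (\<forall>x. Re (quad_form M x) \<ge> 0)"

text \<open>The order type class on vectors is componentwise, hence a separate symbol.\<close>

definition loewner_le :: "complex^'n^'n \<Rightarrow> complex^'n^'n \<Rightarrow> bool" (infix \<open>\<le>\<^sub>L\<close> 50) where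
  "M \<le>\<^sub>L N \<longleftrightarrow> pos_semidef (N - M)"

definition eigenvalues :: "complex^'n^'n \<Rightarrow> complex set" where
  "eigenvalues M = {c. \<exists>v. v \<noteq> 0 \<and> M *v v = c *s v}"

text \<open>The maximum is taken over a finite nonempty set.\<close>

definition spectral_radius :: "complex^'n^'n \<Rightarrow> real" where
  "spectral_radius M = Max (cmod ` eigenvalues M)"

definition block_diag :: "complex^'m^'m \<Rightarrow> complex^'k^'k \<Rightarrow> complex^('m + 'k)^('m + 'k)" where
  "block_diag M N = (\<chi> i j. case (i, j) of
      (Inl a, Inl b) \<Rightarrow> M $ a $ b
    | (Inr a, Inr b) \<Rightarrow> N $ a $ b
    | _ \<Rightarrow> 0)"

definition block_row :: "complex^'m^'n \<Rightarrow> complex^'k^'n \<Rightarrow> complex^('m + 'k)^'n" where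
  "block_row M N = (\<chi> i j. case j of Inl a \<Rightarrow> M $ i $ a | Inr b \<Rightarrow> N $ i $ b)"


section \<open>The conjugate equation\<close>

definition R_mat :: "complex^'m^'n \<Rightarrow> complex^'m^'m \<Rightarrow> complex^'n^'n \<Rightarrow> complex^'m^'m" where
  "R_mat B R X = R + conj_transpose B ** conj_mat X ** B"

definition G_mat :: "complex^'m^'n \<Rightarrow> complex^'m^'m \<Rightarrow> complex^'n^'n" where
  "G_mat B R = B ** matrix_inv R ** conj_transpose B"

definition cdom :: "complex^'m^'n \<Rightarrow> complex^'m^'m \<Rightarrow> (complex^'n^'n) set" where
  "cdom B R = {X. hermitian X \<and> det (R_mat B R X) \<noteq> 0}"

text \<open>\<open>matrix_inv\<close> is meaningful only for invertible matrices; the operators below are therefore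
  only ever used on their domains.\<close>

definition cric :: "complex^'n^'n \<Rightarrow> complex^'m^'n \<Rightarrow> complex^'m^'m \<Rightarrow> complex^'n^'n
    \<Rightarrow> complex^'n^'n \<Rightarrow> complex^'n^'n" where
  "cric A B R H X =
     conj_transpose A ** conj_mat X ** A
     - conj_transpose A ** conj_mat X ** B ** matrix_inv (R_mat B R X)
         ** conj_transpose B ** conj_mat X ** A
     + H"

definition F_mat :: "complex^'n^'n \<Rightarrow> complex^'m^'n \<Rightarrow> complex^'m^'m
    \<Rightarrow> complex^'n^'n \<Rightarrow> complex^'n^'m" where
  "F_mat A B R X = matrix_inv (R_mat B R X) ** conj_transpose B ** conj_mat X ** A"

definition T_mat :: "complex^'n^'n \<Rightarrow> complex^'m^'n \<Rightarrow> complex^'m^'m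
    \<Rightarrow> complex^'n^'n \<Rightarrow> complex^'n^'n" where
  "T_mat A B R X = A - B ** F_mat A B R X"

definition T_hat :: "complex^'n^'n \<Rightarrow> complex^'m^'n \<Rightarrow> complex^'m^'m
    \<Rightarrow> complex^'n^'n \<Rightarrow> complex^'n^'n" where
  "T_hat A B R X = conj_mat (T_mat A B R X) ** T_mat A B R X"

definition R_le_set :: "complex^'n^'n \<Rightarrow> complex^'m^'n \<Rightarrow> complex^'m^'m \<Rightarrow> complex^'n^'n
    \<Rightarrow> (complex^'n^'n) set" where
  "R_le_set A B R H = {X \<in> cdom B R. X \<le>\<^sub>L cric A B R H X}"

definition P_set :: "complex^'m^'n \<Rightarrow> complex^'m^'m \<Rightarrow> (complex^'n^'n) set" where
  "P_set B R = {X \<in> cdom B R. pos_def (R_mat B R X)}"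

definition T_set :: "complex^'n^'n \<Rightarrow> complex^'m^'n \<Rightarrow> complex^'m^'m \<Rightarrow> (complex^'n^'n) set" where
  "T_set A B R = {X \<in> cdom B R. spectral_radius (T_hat A B R X) < 1}"

definition cdare_solutions :: "complex^'n^'n \<Rightarrow> complex^'m^'n \<Rightarrow> complex^'m^'m \<Rightarrow> complex^'n^'n
    \<Rightarrow> (complex^'n^'n) set" where
  "cdare_solutions A B R H = {X \<in> P_set B R. X = cric A B R H X}"


section \<open>The transformed equation\<close>

definition A_hat :: "complex^'n^'n \<Rightarrow> complex^'m^'n \<Rightarrow> complex^'m^'m \<Rightarrow> complex^'n^'n
    \<Rightarrow> complex^'n^'n" where
  "A_hat A B R H =
     conj_mat A ** A
     - conj_mat A ** B ** matrix_inv (R_mat B R H) ** conj_transpose B ** conj_mat H ** A"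

definition B_hat :: "complex^'n^'n \<Rightarrow> complex^'m^'n \<Rightarrow> complex^('m + 'm)^'n" where
  "B_hat A B = block_row (conj_mat B) (conj_mat A ** B)"

definition R_hat :: "complex^'m^'n \<Rightarrow> complex^'m^'m \<Rightarrow> complex^'n^'n
    \<Rightarrow> complex^('m + 'm)^('m + 'm)" where
  "R_hat B R H = block_diag (conj_mat R) (R_mat B R H)"

definition H_hat :: "complex^'n^'n \<Rightarrow> complex^'m^'n \<Rightarrow> complex^'m^'m \<Rightarrow> complex^'n^'n
    \<Rightarrow> complex^'n^'n" where
  "H_hat A B R H =
     H + conj_transpose A ** conj_mat H ** matrix_inv (mat 1 + G_mat B R ** conj_mat H) ** A"

definition R_hat_mat :: "complex^'n^'n \<Rightarrow> complex^'m^'n \<Rightarrow> complex^'m^'m \<Rightarrow> complex^'n^'n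
    \<Rightarrow> complex^'n^'n \<Rightarrow> complex^('m + 'm)^('m + 'm)" where
  "R_hat_mat A B R H X = R_hat B R H + conj_transpose (B_hat A B) ** X ** B_hat A B"

definition ddom :: "complex^'n^'n \<Rightarrow> complex^'m^'n \<Rightarrow> complex^'m^'m \<Rightarrow> complex^'n^'n
    \<Rightarrow> (complex^'n^'n) set" where
  "ddom A B R H = {X. hermitian X \<and> det (R_hat_mat A B R H X) \<noteq> 0}"

definition dric :: "complex^'n^'n \<Rightarrow> complex^'m^'n \<Rightarrow> complex^'m^'m \<Rightarrow> complex^'n^'n
    \<Rightarrow> complex^'n^'n \<Rightarrow> complex^'n^'n" where
  "dric A B R H X =
     conj_transpose (A_hat A B R H) ** X ** A_hat A B R H
     - conj_transpose (A_hat A B R H) ** X ** B_hat A B ** matrix_inv (R_hat_mat A B R H X)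
         ** conj_transpose (B_hat A B) ** X ** A_hat A B R H
     + H_hat A B R H"

definition P_hat_set :: "complex^'n^'n \<Rightarrow> complex^'m^'n \<Rightarrow> complex^'m^'m \<Rightarrow> complex^'n^'n
    \<Rightarrow> (complex^'n^'n) set" where
  "P_hat_set A B R H = {X \<in> ddom A B R H. pos_def (R_hat_mat A B R H X)}"

definition dare_solutions :: "complex^'n^'n \<Rightarrow> complex^'m^'n \<Rightarrow> complex^'m^'m \<Rightarrow> complex^'n^'n
    \<Rightarrow> (complex^'n^'n) set" where
  "dare_solutions A B R H = {X \<in> P_hat_set A B R H. X = dric A B R H X}"


section \<open>Maximal solutions\<close>

text \<open>By antisymmetry of the Loewner order a set has at most one such element.\<close>

definition maximal_solution :: "(complex^'n^'n) set \<Rightarrow> complex^'n^'n \<Rightarrow> bool" where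
  "maximal_solution S X \<longleftrightarrow> X \<in> S \<and> (\<forall>Y\<in>S. Y \<le>\<^sub>L X)"

end

theory Submission
  imports Defs "HOL-Computational_Algebra.Fundamental_Theorem_Algebra"
begin

text \<open>
  For \<open>R\<^sub>X > 0\<close> the value of the quadratic form of \<open>cric X\<close> at \<open>x\<close> is the minimum over inputs \<open>u\<close> of a
  one-step quadratic cost with terminal weight the conjugate of \<open>X\<close>. Two such steps give the cost
  whose minimum is \<open>dric X\<close>; hence \<open>dric\<close> is \<open>cric\<close> composed with itself, and \<open>R_hat_mat X > 0\<close> iff
  both \<open>R\<^sub>X > 0\<close> and \<open>R\<^sub>Y > 0\<close> for \<open>Y = cric X\<close>. A solution \<open>Y\<close> of either equation therefore belongs to
  a pair \<open>(Y, Z)\<close> with \<open>Y \<le> cric Z\<close> and \<open>Z \<le> cric Y\<close>.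

  A stabilizing feedback from \<open>T_set\<close> gives a Stein equation whose solution \<open>U\<close> dominates every such
  pair and satisfies \<open>cric U \<le> U\<close>. Since \<open>cric\<close> is monotone, its iterates from \<open>U\<close> decrease and stay
  above all pairs; their limit is the common maximal solution.
\<close>

subsection \<open>Hermitian matrices and their quadratic forms\<close>

definition vec_cnj :: "complex^'n \<Rightarrow> complex^'n" where
  "vec_cnj x = (\<chi> i. cnj (x $ i))"

text \<open>Here \<open>\<bullet>\<close> is the real inner product on the Euclidean space
  \<open>complex^'n\<close>, so this is the real part of the sesquilinear form. Staying real-valued
  gives direct access to order and monotone limits.\<close>

definition hq :: "complex^'n^'n \<Rightarrow> complex^'n \<Rightarrow> real" where
  "hq M x = x \<bullet> (M *v x)"

lemma Re_quad_form: "Re (quad_form M x) = hq M x"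
  by (simp add: quad_form_def hq_def inner_vec_def inner_complex_def)

lemma vec_cnj_vec_cnj [simp]: "vec_cnj (vec_cnj x) = x"
  by (simp add: vec_cnj_def vec_eq_iff)

lemma conj_mat_conj_mat [simp]: "conj_mat (conj_mat M) = M"
  by (simp add: conj_mat_def vec_eq_iff)

lemma conj_transpose_conj_transpose [simp]: "conj_transpose (conj_transpose M) = M"
  by (simp add: conj_transpose_def conj_mat_def vec_eq_iff transpose_def)

lemma conj_transpose_conj_mat: "conj_transpose (conj_mat M) = conj_mat (conj_transpose M)"
  by (simp add: conj_transpose_def conj_mat_def vec_eq_iff transpose_def)

lemma conj_mat_mult: "conj_mat (M ** N) = conj_mat M ** conj_mat N"
  by (simp add: conj_mat_def vec_eq_iff matrix_matrix_mult_def)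

lemma conj_mat_add: "conj_mat (M + N) = conj_mat M + conj_mat N"
  by (simp add: conj_mat_def vec_eq_iff)

lemma conj_mat_diff: "conj_mat (M - N) = conj_mat M - conj_mat N"
  by (simp add: conj_mat_def vec_eq_iff)

lemma conj_mat_scaleR: "conj_mat (r *\<^sub>R M) = r *\<^sub>R conj_mat M"
  by (simp add: conj_mat_def vec_eq_iff)

lemma conj_mat_mat_1 [simp]: "conj_mat (mat 1) = mat 1"
  by (simp add: conj_mat_def vec_eq_iff mat_def)

lemma vec_cnj_mult: "vec_cnj (M *v x) = conj_mat M *v vec_cnj x"
  by (simp add: conj_mat_def vec_cnj_def vec_eq_iff matrix_vector_mult_def)

lemma conj_transpose_mult: "conj_transpose (M ** N) = conj_transpose N ** conj_transpose M"
  by (simp add: conj_transpose_def conj_mat_mult matrix_transpose_mul)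

lemma conj_transpose_add: "conj_transpose (M + N) = conj_transpose M + conj_transpose N"
  by (simp add: conj_transpose_def conj_mat_def vec_eq_iff transpose_def)

lemma conj_transpose_diff: "conj_transpose (M - N) = conj_transpose M - conj_transpose N"
  by (simp add: conj_transpose_def conj_mat_def vec_eq_iff transpose_def)

lemma conj_transpose_mat_1 [simp]: "conj_transpose (mat 1) = mat 1"
  by (simp add: conj_transpose_def)

lemma matrix_diff_ldistrib: "A ** (B - C) = A ** B - A ** (C :: complex^'m^'n)"
  by (simp add: matrix_eq matrix_vector_mult_diff_distrib matrix_vector_mult_diff_rdistrib
      flip: matrix_vector_mul_assoc)

lemma matrix_diff_rdistrib: "(A - B) ** C = A ** C - B ** (C :: complex^'m^'n)"
  by (simp add: matrix_eq matrix_vector_mult_diff_rdistrib flip: matrix_vector_mul_assoc)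

lemma inner_vec_cnj: "x \<bullet> y = Re (\<Sum>i\<in>UNIV. cnj (x $ i) * y $ i)"
  by (simp add: inner_vec_def inner_complex_def)

lemma inner_mult_conj_transpose: "(M *v x) \<bullet> y = x \<bullet> (conj_transpose M *v y)"
proof -
  have "(\<Sum>i\<in>UNIV. cnj ((M *v x) $ i) * y $ i)
      = (\<Sum>i\<in>UNIV. \<Sum>j\<in>UNIV. cnj (x $ j) * (cnj (M $ i $ j) * y $ i))"
    by (simp add: matrix_vector_mult_def sum_distrib_right sum_distrib_left algebra_simps)
  also have "\<dots> = (\<Sum>j\<in>UNIV. \<Sum>i\<in>UNIV. cnj (x $ j) * (cnj (M $ i $ j) * y $ i))"
    by (rule sum.swap)
  also have "\<dots> = (\<Sum>j\<in>UNIV. cnj (x $ j) * (conj_transpose M *v y) $ j)"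
    by (simp add: matrix_vector_mult_def sum_distrib_left
        conj_transpose_def conj_mat_def transpose_def)
  finally show ?thesis
    by (simp only: inner_vec_cnj)
qed

lemma inner_hermitian: "hermitian M \<Longrightarrow> (M *v x) \<bullet> y = x \<bullet> (M *v y)"
  by (simp add: inner_mult_conj_transpose hermitian_def)

lemma hermitian_add: "hermitian M \<Longrightarrow> hermitian N \<Longrightarrow> hermitian (M + N)"
  by (simp add: hermitian_def conj_transpose_add)

lemma hermitian_diff: "hermitian M \<Longrightarrow> hermitian N \<Longrightarrow> hermitian (M - N)"
  by (simp add: hermitian_def conj_transpose_diff)

lemma hermitian_conj_mat: "hermitian M \<Longrightarrow> hermitian (conj_mat M)"
  by (simp add: hermitian_def conj_transpose_conj_mat)

lemma hermitian_congruence: "hermitian M \<Longrightarrow> hermitian (conj_transpose C ** M ** C)"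
  by (simp add: hermitian_def conj_transpose_mult matrix_mul_assoc)

lemma matrix_inv_left_right:
  fixes M :: "complex^'n^'n"
  assumes "det M \<noteq> 0"
  shows "matrix_inv M ** M = mat 1" "M ** matrix_inv M = mat 1"
  using someI_ex[of "\<lambda>A'. M ** A' = mat 1 \<and> A' ** M = mat 1"] assms
  by (auto simp: matrix_inv_def invertible_def simp flip: invertible_det_nz)

lemma matrix_inv_eqI:
  fixes M :: "complex^'n^'n"
  assumes "M ** N = mat 1"
  shows "matrix_inv M = N"
proof -
  have "N ** M = mat 1"
    using assms matrix_left_right_inverse by blast
  then have "matrix_inv M ** M = mat 1"
    using someI_ex[of "\<lambda>A'. M ** A' = mat 1 \<and> A' ** M = mat 1"] assms
    by (auto simp: matrix_inv_def)
  then have "(matrix_inv M ** M) ** N = N"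
    by simp
  then show ?thesis
    by (simp add: assms flip: matrix_mul_assoc)
qed

lemma hermitian_matrix_inv:
  assumes "hermitian M" "det M \<noteq> 0"
  shows "hermitian (matrix_inv M)"
proof -
  have "M ** conj_transpose (matrix_inv M) = mat 1"
    using arg_cong[OF matrix_inv_left_right(1)[OF assms(2)], of conj_transpose] assms(1)
    by (simp add: conj_transpose_mult hermitian_def)
  then show ?thesis
    unfolding hermitian_def by (rule matrix_inv_eqI[symmetric])
qed

lemma conj_mat_matrix_inv:
  assumes "det M \<noteq> 0"
  shows "conj_mat (matrix_inv M) = matrix_inv (conj_mat M)"
  using arg_cong[OF matrix_inv_left_right(2)[OF assms], of conj_mat]
  by (intro matrix_inv_eqI[symmetric]) (simp add: conj_mat_mult)

lemma hq_add: "hq (M + N) x = hq M x + hq N x"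
  by (simp add: hq_def matrix_vector_mult_add_rdistrib inner_add_right)

lemma hq_diff: "hq (M - N) x = hq M x - hq N x"
  by (simp add: hq_def matrix_vector_mult_diff_rdistrib inner_diff_right)

lemma hq_0_right [simp]: "hq M 0 = 0"
  by (simp add: hq_def)

lemma hq_congruence: "hq (conj_transpose C ** M ** C) x = hq M (C *v x)"
  by (simp add: hq_def inner_mult_conj_transpose flip: matrix_vector_mul_assoc)

text \<open>Entrywise conjugation preserves the real inner product, so conjugating the matrix
  amounts to conjugating the argument. Loewner inequalities therefore pass to conjugates.\<close>

lemma hq_conj_mat: "hq (conj_mat M) x = hq M (vec_cnj x)"
proof -
  have "vec_cnj x \<bullet> vec_cnj y = x \<bullet> y" for y
    by (simp add: vec_cnj_def inner_vec_def inner_complex_def)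
  from this[of "conj_mat M *v x"] show ?thesis
    by (simp add: hq_def vec_cnj_mult)
qed

lemma hq_polarization:
  assumes "hermitian M"
  shows "x \<bullet> (M *v y) = (hq M (x + y) - hq M x - hq M y) / 2"
  using inner_hermitian[OF assms, of y x]
  by (simp add: hq_def matrix_vector_right_distrib inner_add_left inner_add_right inner_commute)

text \<open>Polarization recovers all real inner products of x with M y from the quadratic form, and
  these determine M y.\<close>

lemma hermitian_eqI:
  assumes "hermitian M" "hermitian N" "\<And>x. hq M x = hq N x"
  shows "M = N"
proof -
  have "M *v y = N *v y" for y
    using assms by (intro vector_eq_ldot[THEN iffD1]) (simp add: hq_polarization)
  then show ?thesis
    by (simp add: matrix_eq)
qed

lemma loewner_le_iff:
  assumes "hermitian M" "hermitian N"
  shows "M \<le>\<^sub>L N \<longleftrightarrow> (\<forall>x. hq M x \<le> hq N x)"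
  using assms by (simp add: loewner_le_def pos_semidef_def Re_quad_form hq_diff hermitian_diff)

lemma pos_def_iff: "pos_def M \<longleftrightarrow> hermitian M \<and> (\<forall>x. x \<noteq> 0 \<longrightarrow> hq M x > 0)"
  by (simp add: pos_def_def Re_quad_form)

lemma pos_def_hq_nonneg: "pos_def M \<Longrightarrow> hq M x \<ge> 0"
  by (cases "x = 0") (auto simp: pos_def_iff intro: less_imp_le)

lemma pos_def_det_nonzero:
  assumes "pos_def M"
  shows "det M \<noteq> 0"
proof -
  have "inj ((*v) M)"
  proof (rule vec.inj_on_iff_eq_0[THEN iffD2], safe)
    fix x assume "M *v x = 0"
    then show "x = 0"
      using assms by (force simp: pos_def_iff hq_def)
  qed auto
  then have "invertible M"
    by (metis invertible_left_inverse matrix_left_invertible_injective)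
  then show ?thesis
    by (simp add: invertible_det_nz)
qed

lemma vec_cnj_eq_0_iff [simp]: "vec_cnj x = 0 \<longleftrightarrow> x = 0"
  by (simp add: vec_cnj_def vec_eq_iff)

lemma pos_def_conj_mat: "pos_def M \<Longrightarrow> pos_def (conj_mat M)"
  by (simp add: pos_def_iff hermitian_conj_mat hq_conj_mat)

subsection \<open>Powers of matrices with eigenvalues in the open unit disc\<close>

text \<open>This is p(M) v, evaluated by Horner's scheme directly on vectors, which avoids forming
  matrix powers.\<close>

definition poly_apply :: "complex^'n^'n \<Rightarrow> complex poly \<Rightarrow> complex^'n \<Rightarrow> complex^'n" where
  "poly_apply M p v = fold_coeffs (\<lambda>a w. a *s v + M *v w) p 0"

lemma poly_apply_0 [simp]: "poly_apply M 0 v = 0"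
  by (simp add: poly_apply_def)

lemma poly_apply_pCons [simp]: "poly_apply M (pCons a p) v = a *s v + M *v poly_apply M p v"
  by (cases "p = 0 \<and> a = 0") (auto simp: poly_apply_def)

lemma poly_apply_add: "poly_apply M (p + q) v = poly_apply M p v + poly_apply M q v"
proof (induction p arbitrary: q)
  case (pCons a p)
  then show ?case
    by (cases q) (simp add: algebra_simps)
qed simp

lemma poly_apply_diff: "poly_apply M (p - q) v = poly_apply M p v - poly_apply M q v"
  using poly_apply_add[of M "p - q" q v] by (simp add: eq_diff_eq)

lemma poly_apply_smult: "poly_apply M (smult c p) v = c *s poly_apply M p v"
  by (induction p) (simp_all add: vec.scale vec.scale_right_distrib)

lemma poly_apply_add_right: "poly_apply M p (v + w) = poly_apply M p v + poly_apply M p w"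
  by (induction p) (simp_all add: algebra_simps)

lemma poly_apply_scale_right: "poly_apply M p (c *s v) = c *s poly_apply M p v"
  by (induction p) (simp_all add: vec.scale vec.scale_right_distrib mult.commute)

lemma poly_apply_diff_right: "poly_apply M p (v - w) = poly_apply M p v - poly_apply M p w"
  using poly_apply_add_right[of M p "v - w" w] by (simp add: eq_diff_eq)

lemma poly_apply_0_right [simp]: "poly_apply M p 0 = 0"
  by (induction p) simp_all

lemma poly_apply_sum_right: "poly_apply M p (\<Sum>i\<in>I. f i) = (\<Sum>i\<in>I. poly_apply M p (f i))"
  by (induction I rule: infinite_finite_induct) (simp_all add: poly_apply_add_right)

lemma poly_apply_mult: "poly_apply M (p * q) v = poly_apply M p (poly_apply M q v)"
  by (induction p) (simp_all add: poly_apply_add poly_apply_smult)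

lemma poly_apply_commute: "poly_apply M p (M *v v) = M *v poly_apply M p v"
  by (induction p) (simp_all add: vec.scale algebra_simps)

lemma poly_apply_eigenvector:
  assumes "M *v v = c *s v"
  shows "poly_apply M p v = poly p c *s v"
  by (induction p) (simp_all add: assms vec.scale vec.scale_left_distrib mult.commute)

lemma poly_apply_linear_factor:
  "poly_apply M ([:- c, 1:] * q) v = M *v poly_apply M q v - c *s poly_apply M q v"
  by (simp add: poly_apply_diff poly_apply_smult)

lemma poly_apply_monom: "poly_apply M (monom c k) v = c *s (((*v) M ^^ k) v)"
  by (induction k) (simp_all add: monom_0 monom_Suc vec.scale)

lemma poly_apply_sum: "poly_apply M (\<Sum>i\<in>I. f i) v = (\<Sum>i\<in>I. poly_apply M (f i) v)"
  by (induction I rule: infinite_finite_induct) (simp_all add: poly_apply_add)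

text \<open>The vectors v, M v, M^2 v, ... up to exponent \<open>CARD('n)\<close> are one more than
  the dimension, hence linearly dependent.\<close>

lemma annihilating_poly_exists:
  fixes M :: "complex^'n^'n"
  obtains p where "p \<noteq> 0" "poly_apply M p v = 0"
proof -
  define x where "x k = ((*v) M ^^ k) v" for k
  let ?I = "{..CARD('n)}"
  \<comment> \<open>Dependence is a property of sets, so a repetition among the powers is treated
    separately; it gives a difference of two monomials.\<close>
  show ?thesis
  proof (cases "inj_on x ?I")
    case False
    then obtain i j where "x i = x j" "i \<noteq> j"
      by (auto simp: inj_on_def)
    then have "monom 1 i - monom 1 j \<noteq> (0::complex poly)"
      and "poly_apply M (monom 1 i - monom 1 j) v = 0"
      by (auto simp: poly_apply_diff poly_apply_monom x_def monom_eq_iff')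
    then show ?thesis
      by (rule that)
  next
    case True
    then have "card (x ` ?I) = CARD('n) + 1"
      by (simp add: card_image)
    moreover have "vec.dim (x ` ?I) \<le> CARD('n)"
      by (rule dim_subset_UNIV_cart_gen)
    ultimately have "vec.dependent (x ` ?I)"
      by (intro vec.dependent_biggerset_general) simp
    then obtain u where u: "\<exists>w\<in>x ` ?I. u w \<noteq> 0" "(\<Sum>w\<in>x ` ?I. u w *s w) = 0"
      by (auto simp: vec.dependent_finite)
    define p where "p = (\<Sum>i\<in>?I. monom (u (x i)) i)"
    have "coeff p i = u (x i)" if "i \<in> ?I" for i
      using that by (simp add: p_def coeff_sum)
    then have "p \<noteq> 0"
      using u(1) by auto
    moreover have "poly_apply M p v = 0"
      using u(2) True by (simp add: p_def poly_apply_sum poly_apply_monom sum.reindex flip: x_def)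
    ultimately show ?thesis
      using that by blast
  qed
qed

text \<open>A product of annihilating polynomials of the basis vectors annihilates every vector, so
  all eigenvalues are roots of it. Finiteness makes the \<open>Max\<close> in
  \<open>spectral_radius\<close> a genuine bound on each eigenvalue.\<close>

lemma finite_eigenvalues: "finite (eigenvalues (M :: complex^'n^'n))"
proof -
  have "\<exists>p. p \<noteq> 0 \<and> poly_apply M p v = 0" for v
    by (metis annihilating_poly_exists)
  then obtain p where p: "\<And>v. p v \<noteq> 0" "\<And>v. poly_apply M (p v) v = 0"
    by metis
  define P where "P = (\<Prod>i\<in>UNIV. p (axis i 1 :: complex^'n))"
  \<comment> \<open>Multiplication of polynomials is commutative, so the factor that kills this
    basis vector can be applied first.\<close>
  have axis: "poly_apply M P (axis i 1) = 0" for i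
  proof -
    have "p (axis i 1) dvd P"
      unfolding P_def by (intro dvd_prodI) auto
    then obtain r where "P = r * p (axis i 1)"
      by (metis dvdE mult.commute)
    then show ?thesis
      by (simp add: poly_apply_mult p(2))
  qed
  have "poly P c = 0" if "c \<in> eigenvalues M" for c
  proof -
    obtain v where v: "v \<noteq> 0" "M *v v = c *s v"
      using \<open>c \<in> eigenvalues M\<close> by (auto simp: eigenvalues_def)
    have "poly_apply M P v = poly_apply M P (\<Sum>i\<in>UNIV. v $ i *s axis i 1)"
      by (simp only: basis_expansion)
    also have "\<dots> = 0"
      by (simp add: poly_apply_sum_right poly_apply_scale_right axis)
    finally show ?thesis
      using v by (simp add: poly_apply_eigenvector)
  qed
  moreover have "P \<noteq> 0"
    using p(1) by (simp add: P_def)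
  ultimately show ?thesis
    by (metis (mono_tags) finite_subset mem_Collect_eq poly_roots_finite subsetI)
qed

text \<open>A contraction forgets its starting value geometrically, and a vanishing perturbation
  contributes arbitrarily little once its initial part is dropped.\<close>

lemma tendsto_0_linear_recurrence:
  fixes x w :: "nat \<Rightarrow> 'a::real_normed_vector"
  assumes step: "\<And>k. norm (x (Suc k)) \<le> c * norm (x k) + norm (w k)"
    and c: "0 \<le> c" "c < 1" and w: "w \<longlonglongrightarrow> 0"
  shows "x \<longlonglongrightarrow> 0"
proof (rule LIMSEQ_I)
  fix r :: real assume r: "r > 0"
  \<comment> \<open>Chosen so that c r/2 + e = r/2: the bound r/2 reproduces itself under the
    recurrence.\<close>
  define e where "e = (1 - c) * (r / 2)"
  have e: "e > 0"
    using r c by (simp add: e_def)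
  obtain N where N: "\<And>k. k \<ge> N \<Longrightarrow> norm (w k) < e"
    using LIMSEQ_D[OF w e] by auto
  have bound: "norm (x (N + k)) \<le> c ^ k * norm (x N) + r / 2" for k
  proof (induction k)
    case 0 then show ?case using r by simp
  next
    case (Suc k)
    have "norm (x (N + Suc k)) \<le> c * norm (x (N + k)) + norm (w (N + k))"
      using step by simp
    also have "\<dots> \<le> c * (c ^ k * norm (x N) + r / 2) + e"
      using Suc c N[of "N + k"] by (intro add_mono mult_left_mono) auto
    finally show ?case
      by (simp add: e_def field_simps)
  qed
  have "(\<lambda>k. c ^ k * norm (x N)) \<longlonglongrightarrow> 0"
    using c by (intro tendsto_mult_left_zero LIMSEQ_realpow_zero)
  then obtain K where K: "\<And>k. k \<ge> K \<Longrightarrow> c ^ k * norm (x N) < r / 2"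
    using LIMSEQ_D[of _ 0 "r / 2"] r c by (fastforce simp: abs_mult)
  show "\<exists>no. \<forall>n\<ge>no. norm (x n - 0) < r"
  proof (intro exI[of _ "N + K"] allI impI)
    fix n assume "n \<ge> N + K"
    then have "K \<le> n - N" "N + (n - N) = n"
      by simp_all
    then show "norm (x n - 0) < r"
      using bound[of "n - N"] K[of "n - N"] by simp
  qed
qed

lemma norm_scale_vec: "norm (c *s v) = cmod c * norm (v :: complex^'n)"
  by (simp add: norm_vec_def norm_mult L2_set_right_distrib)

text \<open>Induction on the degree replaces the Jordan form. Write p = (X - c) q. Either q(M) v = 0
  and q has smaller degree, or q(M) v is an eigenvector for c. In the latter case |c| < 1 and q
  annihilates M v - c v, so M^k v satisfies a recurrence with factor c and a perturbation that
  vanishes by induction.\<close>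

lemma powers_tendsto_0_if_annihilated:
  fixes M :: "complex^'n^'n"
  assumes stable: "\<And>c. c \<in> eigenvalues M \<Longrightarrow> cmod c < 1"
    and "p \<noteq> 0" "poly_apply M p v = 0"
  shows "(\<lambda>k. ((*v) M ^^ k) v) \<longlonglongrightarrow> 0"
  using assms(2,3)
proof (induction "degree p" arbitrary: p v)
  case 0
  then obtain a where "p = [:a:]" "a \<noteq> 0"
    by (metis degree_eq_zeroE pCons_0_0)
  then have "v = 0"
    using 0 by simp
  moreover have "((*v) M ^^ k) 0 = 0" for k
    by (induction k) simp_all
  ultimately show ?case
    by simp
next
  case (Suc d)
  then have "\<not> constant (poly p)"
    by (simp add: constant_degree)
  then obtain c where "poly p c = 0"
    using fundamental_theorem_of_algebra by blast
  then obtain q where q: "p = [:- c, 1:] * q"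
    by (auto simp: poly_eq_0_iff_dvd)
  have q0: "q \<noteq> 0"
    using Suc.prems q by auto
  then have deg: "d = degree q"
    using Suc.hyps(2) q by (simp add: degree_mult_eq del: mult_pCons_left)
  let ?u = "poly_apply M q v"
  have u: "M *v ?u = c *s ?u"
    using Suc.prems(2) by (simp add: q poly_apply_linear_factor del: mult_pCons_left)
  show ?case
  proof (cases "?u = 0")
    case True
    then show ?thesis
      using Suc.hyps(1)[OF deg q0] by simp
  next
    case False
    with u have c: "cmod c < 1"
      by (intro stable) (auto simp: eigenvalues_def)
    \<comment> \<open>Since q(M) commutes with M, the left side is M u - c u for u = q(M) v.\<close>
    have "poly_apply M q (M *v v - c *s v) = 0"
      by (simp add: poly_apply_diff_right poly_apply_scale_right poly_apply_commute u)
    then have lim: "(\<lambda>k. ((*v) M ^^ k) (M *v v - c *s v)) \<longlonglongrightarrow> 0"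
      using Suc.hyps(1)[OF deg q0] by simp
    have step: "((*v) M ^^ Suc k) v = c *s (((*v) M ^^ k) v) + ((*v) M ^^ k) (M *v v - c *s v)" for k
      by (induction k) (simp_all add: algebra_simps vec.scale)
    show ?thesis
    proof (rule tendsto_0_linear_recurrence[OF _ _ c lim])
      show "norm (((*v) M ^^ Suc k) v) \<le> cmod c * norm (((*v) M ^^ k) v)
          + norm (((*v) M ^^ k) (M *v v - c *s v))" for k
        unfolding step norm_scale_vec[symmetric] by (rule norm_triangle_ineq)
    qed auto
  qed
qed

lemma powers_tendsto_0:
  fixes M :: "complex^'n^'n"
  assumes "spectral_radius M < 1"
  shows "(\<lambda>k. ((*v) M ^^ k) v) \<longlonglongrightarrow> 0"
proof -
  obtain p where "p \<noteq> 0" "poly_apply M p v = 0"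
    by (metis annihilating_poly_exists)
  moreover have "cmod c < 1" if "c \<in> eigenvalues M" for c
    using assms Max_ge[OF finite_imageI imageI, OF finite_eigenvalues that, of cmod]
    by (simp add: spectral_radius_def)
  ultimately show ?thesis
    by (intro powers_tendsto_0_if_annihilated)
qed

section \<open>Stein equations and inequalities for a stable matrix\<close>

lemma matrix_vector_mult_minus_right: "M *v (- x) = - (M *v x :: complex^'n)"
  using matrix_vector_mult_diff_distrib[of M 0 x] by simp

lemma hq_minus_right [simp]: "hq M (- x) = hq M x"
  by (simp add: hq_def matrix_vector_mult_minus_right)

lemma matrix_add_rdistrib: "(A + B) ** C = A ** C + B ** (C :: complex^'m^'n)"
  by (simp add: matrix_eq matrix_vector_mult_add_rdistrib flip: matrix_vector_mul_assoc)

lemma matrix_scaleR_left: "(r *\<^sub>R A) ** B = r *\<^sub>R (A ** (B :: complex^'m^'n))"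
  by (simp add: vec_eq_iff matrix_matrix_mult_def scaleR_sum_right)

lemma matrix_scaleR_right: "A ** (r *\<^sub>R B) = r *\<^sub>R (A ** (B :: complex^'m^'n))"
  by (simp add: vec_eq_iff matrix_matrix_mult_def scaleR_sum_right)

lemma tendsto_inner_powers:
  fixes M D :: "complex^'n^'n"
  assumes "\<And>x. (\<lambda>k. ((*v) M ^^ k) x) \<longlonglongrightarrow> 0"
  shows "(\<lambda>k. ((*v) M ^^ k) x \<bullet> (D *v ((*v) M ^^ k) y)) \<longlonglongrightarrow> 0"
proof -
  have "(\<lambda>k. D *v ((*v) M ^^ k) y) \<longlonglongrightarrow> D *v 0"
    by (intro bounded_linear.tendsto[OF matrix_vector_mul_bounded_linear] assms)
  from tendsto_inner[OF assms this] show ?thesis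
    by simp
qed

text \<open>Along the orbit of x the form never exceeds its initial value, yet it tends to
  0.\<close>

lemma hq_nonneg_if_stein_le:
  assumes stable: "\<And>x. (\<lambda>k. ((*v) M ^^ k) x) \<longlonglongrightarrow> 0"
    and le: "\<And>x. hq D (M *v x) \<le> hq D x"
  shows "0 \<le> hq D x"
proof -
  have "hq D (((*v) M ^^ k) x) \<le> hq D x" for k
    by (induction k) (auto intro: order_trans[OF le])
  moreover have "(\<lambda>k. hq D (((*v) M ^^ k) x)) \<longlonglongrightarrow> 0"
    unfolding hq_def by (rule tendsto_inner_powers[OF stable])
  ultimately show ?thesis
    by (intro LIMSEQ_le_const2) auto
qed

text \<open>Substituting the equation into itself removes the conjugation: X is invariant under
  congruence by \<open>conj_mat T ** T\<close>. Its form is then constant along orbits that tend to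
  0.\<close>

lemma stein_conj_unique:
  assumes stable: "\<And>x. (\<lambda>k. ((*v) (conj_mat T ** T) ^^ k) x) \<longlonglongrightarrow> 0"
    and X: "X = conj_transpose T ** conj_mat X ** T"
  shows "X = 0"
proof -
  let ?M = "conj_mat T ** T"
  have "conj_mat X = conj_transpose (conj_mat T) ** X ** conj_mat T"
    using arg_cong[OF X, of conj_mat] by (simp add: conj_mat_mult conj_transpose_conj_mat)
  with X have "X = conj_transpose ?M ** X ** ?M"
    by (metis conj_transpose_mult matrix_mul_assoc)
  then have "x \<bullet> (X *v y) = (?M *v x) \<bullet> (X *v (?M *v y))" for x y
    by (metis inner_mult_conj_transpose matrix_vector_mul_assoc)
  then have "((*v) ?M ^^ k) x \<bullet> (X *v ((*v) ?M ^^ k) y) = x \<bullet> (X *v y)" for x y k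
    by (induction k) simp_all
  then have "x \<bullet> (X *v y) = 0" for x y
    using tendsto_inner_powers[OF stable, of x X y] by (simp add: LIMSEQ_const_iff)
  then have "X *v y = 0 *v y" for y
    by (metis inner_eq_zero_iff matrix_vector_mult_0)
  then show ?thesis
    by (simp add: matrix_eq)
qed

text \<open>Existence follows from uniqueness in finite dimension: an injective linear endomorphism
  is surjective. Because of the conjugation, \<open>L\<close> is treated as linear over the
  reals.\<close>

lemma stein_conj_solution:
  assumes stable: "\<And>x. (\<lambda>k. ((*v) (conj_mat T ** T) ^^ k) x) \<longlonglongrightarrow> 0"
    and Q: "hermitian Q"
  obtains X where "hermitian X" "X = conj_transpose T ** conj_mat X ** T + Q"
proof -
  define L where "L X = X - conj_transpose T ** conj_mat X ** T" for X
  have L_diff: "L (X - Y) = L X - L Y" for X Y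
    by (simp add: L_def conj_mat_diff matrix_diff_ldistrib matrix_diff_rdistrib)
  have lin: "linear L"
    by (rule linearI)
      (simp_all add: L_def conj_mat_add conj_mat_scaleR matrix_add_ldistrib matrix_add_rdistrib
        matrix_scaleR_left matrix_scaleR_right algebra_simps)
  have zero: "X = 0" if "L X = 0" for X
    using that stein_conj_unique[OF stable, of X] by (simp add: L_def)
  then have "inj L"
    by (simp add: linear_injective_0[OF lin])
  then obtain X where X: "L X = Q"
    using linear_injective_imp_surjective[OF lin] by (metis surjD)
  \<comment> \<open>The conjugate transpose solves the same equation, so injectivity makes X
    Hermitian.\<close>
  have "L (conj_transpose X) = conj_transpose (L X)"
    by (simp add: L_def conj_transpose_diff conj_transpose_mult conj_transpose_conj_mat matrix_mul_assoc)
  then have "L (conj_transpose X - X) = 0"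
    using Q by (simp add: L_diff X hermitian_def)
  then have "hermitian X"
    using zero by (fastforce simp: hermitian_def)
  moreover have "X = conj_transpose T ** conj_mat X ** T + Q"
    using X by (simp add: L_def algebra_simps)
  ultimately show ?thesis
    by (rule that)
qed

subsection \<open>The Riccati operator as a minimal cost\<close>

text \<open>The weight W is a free parameter: \<open>conj_mat X\<close> gives the conjugate
  equation, X itself the transformed one. One theory of \<open>gram\<close>, \<open>gain\<close> and
  \<open>ric\<close> thus serves both.\<close>

definition gram :: "complex^'m^'n \<Rightarrow> complex^'m^'m \<Rightarrow> complex^'n^'n \<Rightarrow> complex^'m^'m" where
  "gram B R W = R + conj_transpose B ** W ** B"

definition gain :: "complex^'n^'n \<Rightarrow> complex^'m^'n \<Rightarrow> complex^'m^'m \<Rightarrow> complex^'n^'n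
    \<Rightarrow> complex^'n^'m" where
  "gain A B R W = matrix_inv (gram B R W) ** conj_transpose B ** W ** A"

definition ric :: "complex^'n^'n \<Rightarrow> complex^'m^'n \<Rightarrow> complex^'m^'m \<Rightarrow> complex^'n^'n
    \<Rightarrow> complex^'n^'n \<Rightarrow> complex^'n^'n" where
  "ric A B R H W =
     conj_transpose A ** W ** A
     - conj_transpose A ** W ** B ** matrix_inv (gram B R W) ** conj_transpose B ** W ** A
     + H"

text \<open>The one-step cost of linear-quadratic control for the system that sends x to A x + B
  u.\<close>

definition cost :: "complex^'n^'n \<Rightarrow> complex^'m^'n \<Rightarrow> complex^'m^'m \<Rightarrow> complex^'n^'n
    \<Rightarrow> complex^'n^'n \<Rightarrow> complex^'n \<Rightarrow> complex^'m \<Rightarrow> real" where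
  "cost A B R H W x u = hq W (A *v x + B *v u) + hq R u + hq H x"

lemma R_mat_eq_gram: "R_mat B R X = gram B R (conj_mat X)"
  by (simp add: R_mat_def gram_def)

lemma cric_eq_ric: "cric A B R H X = ric A B R H (conj_mat X)"
  by (simp add: cric_def ric_def R_mat_eq_gram)

lemma hermitian_gram: "hermitian R \<Longrightarrow> hermitian W \<Longrightarrow> hermitian (gram B R W)"
  by (simp add: gram_def hermitian_add hermitian_congruence)

lemma hq_gram: "hq (gram B R W) u = hq R u + hq W (B *v u)"
  by (simp add: gram_def hq_add hq_congruence)

text \<open>For Hermitian W the subtracted term is a congruence of the inverse Gram matrix, which
  shows that it is Hermitian and gives its quadratic form.\<close>

lemma ric_eq_gain:
  assumes "hermitian W"
  shows "ric A B R H W = conj_transpose A ** W ** A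
    - conj_transpose (conj_transpose B ** W ** A) ** matrix_inv (gram B R W)
      ** (conj_transpose B ** W ** A) + H"
  using assms by (simp add: ric_def conj_transpose_mult matrix_mul_assoc hermitian_def)

lemma hermitian_ric:
  assumes "hermitian R" "hermitian H" "hermitian W" "det (gram B R W) \<noteq> 0"
  shows "hermitian (ric A B R H W)"
  using assms unfolding ric_eq_gain[OF assms(3)]
  by (intro hermitian_add hermitian_diff hermitian_congruence hermitian_matrix_inv hermitian_gram)

text \<open>The input minus gain times x cancels the terms linear in u. Invertibility is assumed
  instead of positivity because the identity is also applied at H, where \<open>R_mat B R H\<close>
  may be indefinite.\<close>

lemma complete_square:
  assumes R: "hermitian R" and W: "hermitian W" and det: "det (gram B R W) \<noteq> 0"
  shows "cost A B R H W x u
    = hq (ric A B R H W) x + hq (gram B R W) (u + gain A B R W *v x)"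
proof -
  define K where "K = conj_transpose B ** W ** A"
  define y where "y = gain A B R W *v x"
  have y: "y = matrix_inv (gram B R W) *v (K *v x)"
    by (simp add: y_def gain_def K_def matrix_vector_mul_assoc matrix_mul_assoc)
  have gram_y: "gram B R W *v y = K *v x"
    using det by (simp add: y matrix_vector_mul_assoc matrix_mul_assoc matrix_inv_left_right(2))
  have cross: "(B *v v) \<bullet> (W *v (A *v x)) = v \<bullet> (K *v x)" for v
    by (simp add: K_def inner_mult_conj_transpose flip: matrix_vector_mul_assoc)
  have "hq W (A *v x + B *v u) = hq W (A *v x) + hq W (B *v u) + 2 * (u \<bullet> (K *v x))"
    using cross[of u] inner_hermitian[OF W, of "A *v x" "B *v u"]
    by (simp add: hq_def matrix_vector_right_distrib inner_add_left inner_add_right inner_commute)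
  moreover have "hq (gram B R W) (u + y) = hq (gram B R W) u + 2 * (u \<bullet> (K *v x)) + y \<bullet> (K *v x)"
    using inner_hermitian[OF hermitian_gram[OF R W], of B y u] gram_y
    by (simp add: hq_def matrix_vector_right_distrib inner_add_left inner_add_right inner_commute)
  moreover have "hq (ric A B R H W) x = hq W (A *v x) - y \<bullet> (K *v x) + hq H x"
    unfolding ric_eq_gain[OF W] hq_add hq_diff hq_congruence K_def[symmetric]
    by (simp add: hq_def y inner_commute)
  ultimately show ?thesis
    by (simp add: cost_def hq_gram y_def)
qed

lemma ric_le_cost:
  assumes "hermitian R" "hermitian W" "pos_def (gram B R W)"
  shows "hq (ric A B R H W) x \<le> cost A B R H W x u"
  using complete_square[OF assms(1,2) pos_def_det_nonzero[OF assms(3)]] pos_def_hq_nonneg[OF assms(3)]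
  by simp

lemma ric_eq_cost_gain:
  assumes "hermitian R" "hermitian W" "det (gram B R W) \<noteq> 0"
  shows "hq (ric A B R H W) x = cost A B R H W x (- (gain A B R W *v x))"
  using complete_square[OF assms] by simp

lemma hq_conj_mat_mono:
  assumes "\<And>x. hq X x \<le> hq Y x"
  shows "hq (conj_mat X) x \<le> hq (conj_mat Y) x"
  by (simp add: hq_conj_mat assms)

lemma cost_mono:
  assumes "\<And>x. hq V x \<le> hq W x"
  shows "cost A B R H V x u \<le> cost A B R H W x u"
  by (simp add: cost_def assms)

text \<open>The input that is optimal for W is admissible for V, and for a fixed input the cost is
  monotone in the weight.\<close>

lemma ric_mono:
  assumes "hermitian R" "hermitian V" "hermitian W" "pos_def (gram B R V)" "det (gram B R W) \<noteq> 0"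
    and "\<And>x. hq V x \<le> hq W x"
  shows "hq (ric A B R H V) x \<le> hq (ric A B R H W) x"
proof -
  have "hq (ric A B R H V) x \<le> cost A B R H V x (- (gain A B R W *v x))"
    using assms by (intro ric_le_cost)
  also have "\<dots> \<le> cost A B R H W x (- (gain A B R W *v x))"
    by (intro cost_mono assms)
  finally show ?thesis
    using assms by (simp add: ric_eq_cost_gain)
qed

lemma pos_def_gram_mono:
  fixes B :: "complex^'m^'n"
  assumes "hermitian R" "hermitian W" "pos_def (gram B R V)" "\<And>x. hq V x \<le> hq W x"
  shows "pos_def (gram B R W)"
  unfolding pos_def_iff
proof (intro conjI allI impI)
  fix u :: "complex^'m" assume "u \<noteq> 0"
  then have "0 < hq (gram B R V) u"
    using assms(3) by (simp add: pos_def_iff)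
  also have "\<dots> \<le> hq (gram B R W) u"
    by (simp add: hq_gram assms(4))
  finally show "0 < hq (gram B R W) u" .
qed (use assms in \<open>simp add: hermitian_gram\<close>)

subsection \<open>Monotone limits\<close>

text \<open>Each value of the form is a bounded decreasing real sequence; polarization carries
  convergence over to the inner products, and from there to the entries.\<close>

lemma hermitian_decseq_tendsto:
  fixes X :: "nat \<Rightarrow> complex^'n^'n"
  assumes herm: "\<And>k. hermitian (X k)"
    and dec: "\<And>k x. hq (X (Suc k)) x \<le> hq (X k) x"
    and bound: "\<And>k x. hq Y x \<le> hq (X k) x"
  obtains L where "hermitian L" "\<And>x. (\<lambda>k. hq (X k) x) \<longlonglongrightarrow> hq L x"
proof -
  have "decseq (\<lambda>k. hq (X k) x)" for x
    by (simp add: decseq_Suc_iff dec)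
  then have "convergent (\<lambda>k. hq (X k) x)" for x
    by (metis decseq_convergent bound convergentI)
  then obtain l where l: "\<And>x. (\<lambda>k. hq (X k) x) \<longlonglongrightarrow> l x"
    unfolding convergent_def by metis
  have conv: "convergent (\<lambda>k. x \<bullet> (X k *v y))" for x y
    unfolding hq_polarization[OF herm]
    by (rule convergentI[of _ "(l (x + y) - l x - l y) / 2"], intro tendsto_intros l) simp
  \<comment> \<open>Real and imaginary parts of an entry are real inner products with e_i and \<i>
    e_i.\<close>
  have Re: "Re (M $ i $ j) = axis i 1 \<bullet> (M *v axis j 1)"
    and Im: "Im (M $ i $ j) = axis i \<i> \<bullet> (M *v axis j 1)" for M :: "complex^'n^'n" and i j
    by (simp_all add: inner_axis' inner_complex_def)
      (simp_all add: matrix_vector_mult_def axis_def if_distrib[of "(*) _"] cong: if_cong)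
  define L where "L = (\<chi> i j. Complex (lim (\<lambda>k. Re (X k $ i $ j))) (lim (\<lambda>k. Im (X k $ i $ j))))"
  have entry: "(\<lambda>k. X k $ i $ j) \<longlonglongrightarrow> L $ i $ j" for i j
    unfolding tendsto_complex_iff using conv by (simp add: L_def Re Im convergent_LIMSEQ_iff)
  have "hermitian L"
    unfolding hermitian_def vec_eq_iff
  proof (intro allI)
    fix i j
    have "(\<lambda>k. cnj (X k $ j $ i)) \<longlonglongrightarrow> cnj (L $ j $ i)"
      by (intro tendsto_intros entry)
    moreover have "cnj (X k $ j $ i) = X k $ i $ j" for k
      using herm[of k] by (simp add: hermitian_def conj_transpose_def conj_mat_def vec_eq_iff transpose_def)
    ultimately have "cnj (L $ j $ i) = L $ i $ j"
      using LIMSEQ_unique[OF _ entry[of i j]] by simp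
    then show "conj_transpose L $ i $ j = L $ i $ j"
      by (simp add: conj_transpose_def conj_mat_def transpose_def)
  qed
  moreover have "(\<lambda>k. hq (X k) x) \<longlonglongrightarrow> hq L x" for x
    unfolding hq_def matrix_vector_mult_def
    by (intro tendsto_inner tendsto_const vec_tendstoI) (simp, intro tendsto_intros entry)
  ultimately show ?thesis
    by (rule that)
qed

subsection \<open>The maximal solution of the conjugate equation\<close>

text \<open>A solution Y of the conjugate equation gives the pair (Y, Y), a solution of the
  transformed equation the pair (Y, \<open>cric\<close> Y). Inequalities suffice, so elements of
  \<open>R_le_set\<close> with positive definite \<open>R_mat\<close> qualify as well.\<close>

definition sub_pair :: "complex^'n^'n \<Rightarrow> complex^'m^'n \<Rightarrow> complex^'m^'m \<Rightarrow> complex^'n^'n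
    \<Rightarrow> complex^'n^'n \<Rightarrow> complex^'n^'n \<Rightarrow> bool" where
  "sub_pair A B R H Y Z \<longleftrightarrow> hermitian Y \<and> hermitian Z \<and> pos_def (R_mat B R Y) \<and> pos_def (R_mat B R Z)
     \<and> (\<forall>x. hq Y x \<le> hq (cric A B R H Z) x) \<and> (\<forall>x. hq Z x \<le> hq (cric A B R H Y) x)"

lemma sub_pair_sym: "sub_pair A B R H Y Z \<Longrightarrow> sub_pair A B R H Z Y"
  by (auto simp: sub_pair_def)

lemma hermitian_R_mat: "hermitian R \<Longrightarrow> hermitian X \<Longrightarrow> hermitian (R_mat B R X)"
  by (simp add: R_mat_eq_gram hermitian_gram hermitian_conj_mat)

lemma hermitian_cric:
  assumes "hermitian R" "hermitian H" "hermitian X" "pos_def (R_mat B R X)"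
  shows "hermitian (cric A B R H X)"
  using assms by (simp add: cric_eq_ric R_mat_eq_gram hermitian_ric hermitian_conj_mat pos_def_det_nonzero)

lemma pos_def_R_mat_mono:
  assumes "hermitian R" "hermitian X" "pos_def (R_mat B R Y)" "\<And>x. hq Y x \<le> hq X x"
  shows "pos_def (R_mat B R X)"
  using assms pos_def_gram_mono[of R "conj_mat X" B "conj_mat Y"]
  by (simp add: R_mat_eq_gram hermitian_conj_mat hq_conj_mat_mono)

lemma cric_mono:
  assumes "hermitian R" "hermitian X" "hermitian Y" "pos_def (R_mat B R Y)" "\<And>x. hq Y x \<le> hq X x"
  shows "hq (cric A B R H Y) x \<le> hq (cric A B R H X) x"
  using assms pos_def_det_nonzero[OF pos_def_R_mat_mono[OF assms(1,2,4,5)]]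
  by (simp add: cric_eq_ric R_mat_eq_gram hermitian_conj_mat hq_conj_mat_mono ric_mono)

lemma cric_le_cost:
  assumes "hermitian R" "hermitian X" "pos_def (R_mat B R X)"
  shows "hq (cric A B R H X) x \<le> cost A B R H (conj_mat X) x u"
  using assms by (simp add: cric_eq_ric R_mat_eq_gram hermitian_conj_mat ric_le_cost)

text \<open>X is the cost of a fixed feedback, whereas the pair lies below optimal costs. One
  closed-loop step passes from X - Y to X - Z at a conjugated state; a second step returns to X - Y,
  giving a Stein inequality for \<open>conj_mat T ** T\<close>.\<close>

lemma stabilized_cost_upper_bound:
  fixes A B F
  defines "T \<equiv> A - B ** F"
  assumes R: "hermitian R"
    and stable: "\<And>x. (\<lambda>k. ((*v) (conj_mat T ** T) ^^ k) x) \<longlonglongrightarrow> 0"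
    and X: "\<And>x. hq X x = cost A B R H (conj_mat X) x (- (F *v x))"
    and pair: "sub_pair A B R H Y Z"
  shows "hq Y x \<le> hq X x"
proof -
  have closed_loop: "A *v x + B *v (- (F *v x)) = T *v x" for x
    by (simp add: T_def matrix_vector_mult_diff_rdistrib matrix_vector_mult_minus_right
        flip: matrix_vector_mul_assoc)
  have step: "hq (X - V) (vec_cnj (T *v x)) \<le> hq (X - U) x" if "sub_pair A B R H U V" for U V x
  proof -
    have "hq U x \<le> hq (cric A B R H V) x"
      using that by (simp add: sub_pair_def)
    also have "\<dots> \<le> cost A B R H (conj_mat V) x (- (F *v x))"
      using that R by (intro cric_le_cost) (simp_all add: sub_pair_def)
    \<comment> \<open>Both costs use the same input, so their R and H terms cancel.\<close>
    finally show ?thesis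
      using X[of x] by (simp add: cost_def closed_loop hq_conj_mat hq_diff)
  qed
  have "hq (X - Y) ((conj_mat T ** T) *v x) \<le> hq (X - Y) x" for x
  proof -
    have "hq (X - Y) (vec_cnj (T *v vec_cnj (T *v x))) \<le> hq (X - Z) (vec_cnj (T *v x))"
      using step sub_pair_sym pair by blast
    also have "\<dots> \<le> hq (X - Y) x"
      using step pair by blast
    finally show ?thesis
      by (simp add: vec_cnj_mult flip: matrix_vector_mul_assoc)
  qed
  then have "0 \<le> hq (X - Y) x"
    by (rule hq_nonneg_if_stein_le[OF stable])
  then show ?thesis
    by (simp add: hq_diff)
qed

text \<open>The gain of a member of \<open>T_set\<close> is kept as a fixed feedback F; X is its
  closed-loop cost, obtained from a Stein equation.\<close>

lemma upper_solution_exists: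
  assumes R: "hermitian R" and H: "hermitian H" and T: "T_set A B R \<noteq> {}"
  obtains X F where "hermitian X" "\<And>x. hq X x = cost A B R H (conj_mat X) x (- (F *v x))"
    "\<And>Y Z x. sub_pair A B R H Y Z \<Longrightarrow> hq Y x \<le> hq X x"
proof -
  obtain X0 where "spectral_radius (T_hat A B R X0) < 1"
    using T by (auto simp: T_set_def)
  moreover define F where "F = F_mat A B R X0"
  moreover define T where "T = A - B ** F"
  ultimately have stable: "\<And>x. (\<lambda>k. ((*v) (conj_mat T ** T) ^^ k) x) \<longlonglongrightarrow> 0"
    by (intro powers_tendsto_0) (simp add: T_hat_def T_mat_def)
  \<comment> \<open>This matrix is the running cost under the input - F x.\<close>
  have "hermitian (conj_transpose F ** R ** F + H)"
    by (intro hermitian_add hermitian_congruence R H)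
  then obtain X where X: "hermitian X"
    "X = conj_transpose T ** conj_mat X ** T + (conj_transpose F ** R ** F + H)"
    using stein_conj_solution[OF stable] by blast
  have closed_loop: "A *v x + B *v (- (F *v x)) = T *v x" for x
    by (simp add: T_def matrix_vector_mult_diff_rdistrib matrix_vector_mult_minus_right
        flip: matrix_vector_mul_assoc)
  have cost: "hq X x = cost A B R H (conj_mat X) x (- (F *v x))" for x
    by (subst X(2)) (simp add: cost_def closed_loop hq_add hq_congruence)
  show ?thesis
    using that[OF X(1) cost] stabilized_cost_upper_bound[OF R stable[unfolded T_def] cost] by blast
qed

text \<open>Monotone iteration of \<open>cric\<close> from the upper solution U. For a pair (Y, Z)
  below the current iterate V, Y \<le> \<open>cric\<close> Z \<le> \<open>cric\<close> V, so pairs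
  stay below the next one.\<close>

lemma cdare_solution_above_sub_pairs:
  fixes A H :: "complex^'n^'n" and B :: "complex^'m^'n" and R :: "complex^'m^'m"
  assumes R: "hermitian R" and H: "hermitian H" and T: "T_set A B R \<noteq> {}"
    and ne: "sub_pair A B R H Y0 Z0"
  obtains X where "X \<in> cdare_solutions A B R H"
    "\<And>Y Z x. sub_pair A B R H Y Z \<Longrightarrow> hq Y x \<le> hq X x"
proof -
  obtain U F where U: "hermitian U" "\<And>x. hq U x = cost A B R H (conj_mat U) x (- (F *v x))"
    and above_U: "\<And>Y Z x. sub_pair A B R H Y Z \<Longrightarrow> hq Y x \<le> hq U x"
    using upper_solution_exists[OF R H T] by metis
  \<comment> \<open>Lying above the one given pair keeps \<open>R_mat\<close> positive definite, so
    neither the iteration nor its limit leaves the domain.\<close>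
  have pd: "pos_def (R_mat B R V)"
    if "hermitian V" "\<And>Y Z x. sub_pair A B R H Y Z \<Longrightarrow> hq Y x \<le> hq V x" for V
    using that ne pos_def_R_mat_mono[OF R that(1), of B Y0] by (auto simp: sub_pair_def)
  define X where "X k = (cric A B R H ^^ k) U" for k
  have X_Suc: "X (Suc k) = cric A B R H (X k)" for k
    by (simp add: X_def)
  have X: "hermitian (X k) \<and> (\<forall>Y Z x. sub_pair A B R H Y Z \<longrightarrow> hq Y x \<le> hq (X k) x)" for k
  proof (induction k)
    case 0
    then show ?case using U above_U by (simp add: X_def)
  next
    case (Suc k)
    have "hq Y x \<le> hq (cric A B R H (X k)) x" if "sub_pair A B R H Y Z" for Y Z x
    proof -
      have "hq Y x \<le> hq (cric A B R H Z) x"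
        using that by (simp add: sub_pair_def)
      also have "\<dots> \<le> hq (cric A B R H (X k)) x"
        using that Suc sub_pair_sym[OF that] by (intro cric_mono R) (auto simp: sub_pair_def)
      finally show ?thesis .
    qed
    moreover have "hermitian (cric A B R H (X k))"
      using Suc by (intro hermitian_cric R H pd) auto
    ultimately show ?case
      by (auto simp: X_Suc)
  qed
  have herm: "hermitian (X k)" and above: "sub_pair A B R H Y Z \<Longrightarrow> hq Y x \<le> hq (X k) x" for k x Y Z
    using X by blast+
  have pd_X: "pos_def (R_mat B R (X k))" for k
    by (intro pd herm above)
  have dec: "hq (X (Suc k)) x \<le> hq (X k) x" for k x
  proof (induction k arbitrary: x)
    case 0
    \<comment> \<open>U is the cost of the feedback F, and \<open>cric\<close> U is the minimum over
      all inputs.\<close>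
    have "hq (cric A B R H U) x \<le> cost A B R H (conj_mat U) x (- (F *v x))"
      using pd_X[of 0] by (intro cric_le_cost R U) (simp add: X_def)
    then show ?case
      using U(2) by (simp add: X_def)
  next
    case (Suc k)
    then show ?case
      using cric_mono[OF R herm herm pd_X] X_Suc by metis
  qed
  obtain L where L: "hermitian L" "\<And>x. (\<lambda>k. hq (X k) x) \<longlonglongrightarrow> hq L x"
    using hermitian_decseq_tendsto[of X Y0, OF herm dec above[OF ne]] by blast
  have above_L: "hq Y x \<le> hq L x" if "sub_pair A B R H Y Z" for Y Z x
    by (rule LIMSEQ_le_const[OF L(2)]) (use above that in blast)
  have L_le: "hq L x \<le> hq (X k) x" for k x
    using decseq_ge[OF _ L(2)] dec by (simp add: decseq_Suc_iff)
  have pd_L: "pos_def (R_mat B R L)"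
    by (intro pd L above_L)
  have "hq (cric A B R H L) x = hq L x" for x
  proof (rule antisym)
    have "hq (cric A B R H L) x \<le> hq (X (Suc k)) x" for k
      unfolding X_Suc by (intro cric_mono R herm L pd_L L_le)
    then show "hq (cric A B R H L) x \<le> hq L x"
      by (intro LIMSEQ_le_const[OF LIMSEQ_Suc[OF L(2)]]) auto
    \<comment> \<open>Each iterate is compared at the input optimal for the limit. With the input
      fixed the weight enters the cost linearly, so the limit needs no continuity of the matrix
      inverse.\<close>
    let ?u = "- (gain A B R (conj_mat L) *v x)"
    have "hq L x \<le> cost A B R H (conj_mat (X k)) x ?u" for k
      using L_le[of x "Suc k"] cric_le_cost[OF R herm pd_X, of A H k x ?u] by (simp add: X_Suc)
    moreover have "(\<lambda>k. cost A B R H (conj_mat (X k)) x ?u) \<longlonglongrightarrow> cost A B R H (conj_mat L) x ?u"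
      unfolding cost_def hq_conj_mat by (intro tendsto_intros L)
    ultimately have "hq L x \<le> cost A B R H (conj_mat L) x ?u"
      by (intro LIMSEQ_le_const) auto
    then show "hq L x \<le> hq (cric A B R H L) x"
      using pos_def_det_nonzero[OF pd_L] R L(1)
      by (simp add: cric_eq_ric R_mat_eq_gram ric_eq_cost_gain hermitian_conj_mat)
  qed
  then have "cric A B R H L = L"
    by (intro hermitian_eqI hermitian_cric R H L pd_L)
  then have "L \<in> cdare_solutions A B R H"
    using L(1) pd_L by (simp add: cdare_solutions_def P_set_def cdom_def pos_def_det_nonzero)
  then show ?thesis
    using that above_L by blast
qed

subsection \<open>The transformed operator as a two-step minimal cost\<close>

definition vec_join :: "complex^'m \<Rightarrow> complex^'k \<Rightarrow> complex^('m + 'k)" where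
  "vec_join u v = (\<chi> j. case j of Inl a \<Rightarrow> u $ a | Inr b \<Rightarrow> v $ b)"

lemma vec_join_cases:
  obtains u v where "w = vec_join u v"
proof
  show "w = vec_join (\<chi> a. w $ Inl a) (\<chi> b. w $ Inr b)"
    by (simp add: vec_join_def vec_eq_iff split: sum.split)
qed

lemma vec_join_eq_0_iff [simp]: "vec_join u v = 0 \<longleftrightarrow> u = 0 \<and> v = 0"
  by (auto simp: vec_join_def vec_eq_iff split: sum.splits)

lemma sum_UNIV_Plus:
  "(\<Sum>j\<in>UNIV. f (j :: 'a::finite + 'b::finite))
    = (\<Sum>a\<in>UNIV. f (Inl a)) + (\<Sum>b\<in>UNIV. f (Inr b))"
  by (simp add: sum.Plus o_def flip: UNIV_Plus_UNIV)

lemma block_row_mult_vec_join: "block_row M N *v vec_join u v = M *v u + N *v v"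
  by (simp add: vec_eq_iff matrix_vector_mult_def sum_UNIV_Plus block_row_def vec_join_def)

lemma hq_block_diag: "hq (block_diag M N) (vec_join u v) = hq M u + hq N v"
  by (simp add: hq_def inner_vec_def matrix_vector_mult_def sum_UNIV_Plus block_diag_def vec_join_def)

lemma hermitian_block_diag: "hermitian M \<Longrightarrow> hermitian N \<Longrightarrow> hermitian (block_diag M N)"
  by (auto simp: hermitian_def conj_transpose_def conj_mat_def transpose_def block_diag_def vec_eq_iff
      split: sum.splits)

lemma R_hat_mat_eq_gram: "R_hat_mat A B R H X = gram (B_hat A B) (R_hat B R H) X"
  by (simp add: R_hat_mat_def gram_def)

lemma dric_eq_ric:
  "dric A B R H X = ric (A_hat A B R H) (B_hat A B) (R_hat B R H) (H_hat A B R H) X"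
  by (simp add: dric_def ric_def R_hat_mat_eq_gram)

lemma hermitian_R_hat:
  assumes "hermitian R" "hermitian H"
  shows "hermitian (R_hat B R H)"
  using assms by (simp add: R_hat_def hermitian_block_diag hermitian_conj_mat hermitian_R_mat)

text \<open>The Woodbury identity; with C the product of \<open>conj_transpose B\<close> and
  \<open>conj_mat H\<close> it turns the inverse in \<open>H_hat\<close> into that of
  \<open>R_mat B R H\<close>.\<close>

lemma woodbury:
  fixes B :: "complex^'m^'n"
  assumes "det R \<noteq> 0" "det (R + C ** B) \<noteq> 0"
  shows "matrix_inv (mat 1 + B ** matrix_inv R ** C) = mat 1 - B ** matrix_inv (R + C ** B) ** C"
proof (rule matrix_inv_eqI)
  let ?P = "matrix_inv R" and ?Q = "matrix_inv (R + C ** B)"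
  have "?P ** (R + C ** B) ** ?Q = ?P"
    using assms(2) by (simp add: matrix_inv_left_right(2) flip: matrix_mul_assoc)
  then have "?Q + ?P ** C ** B ** ?Q = ?P"
    using assms(1) by (simp add: matrix_add_ldistrib matrix_add_rdistrib matrix_inv_left_right(1) matrix_mul_assoc)
  then have "B ** (?Q + ?P ** C ** B ** ?Q) ** C = B ** ?P ** C"
    by simp
  then show "(mat 1 + B ** ?P ** C) ** (mat 1 - B ** ?Q ** C) = mat 1"
    by (simp add: matrix_add_ldistrib matrix_add_rdistrib matrix_diff_ldistrib matrix_mul_assoc algebra_simps)
qed

text \<open>This identifies \<open>H_hat\<close> as the state weight left over when the square is
  completed at H.\<close>

lemma H_hat_eq_cric:
  assumes "det R \<noteq> 0" "det (R_mat B R H) \<noteq> 0"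
  shows "H_hat A B R H = cric A B R H H"
proof -
  have "matrix_inv (mat 1 + G_mat B R ** conj_mat H)
    = mat 1 - B ** matrix_inv (R_mat B R H) ** (conj_transpose B ** conj_mat H)"
    using woodbury[of R "conj_transpose B ** conj_mat H" B] assms
    by (simp add: G_mat_def R_mat_def matrix_mul_assoc)
  then show ?thesis
    by (simp add: H_hat_def cric_def matrix_diff_ldistrib matrix_diff_rdistrib matrix_mul_assoc)
qed

lemma hermitian_H_hat:
  assumes "hermitian R" "hermitian H" "det R \<noteq> 0" "det (R_mat B R H) \<noteq> 0"
  shows "hermitian (H_hat A B R H)"
  using assms
  by (simp add: H_hat_eq_cric cric_eq_ric R_mat_eq_gram hermitian_ric hermitian_conj_mat)

lemma conj_mat_R_mat: "conj_mat (R_mat B R X) = gram (conj_mat B) (conj_mat R) X"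
  by (simp add: R_mat_def gram_def conj_mat_add conj_mat_mult conj_transpose_conj_mat)

text \<open>The second step of the two-step cost runs with conjugated data; its minimum is the
  conjugate of \<open>cric\<close> X, exactly the weight that the first step requires.\<close>

lemma conj_mat_cric:
  assumes "det (R_mat B R X) \<noteq> 0"
  shows "conj_mat (cric A B R H X) = ric (conj_mat A) (conj_mat B) (conj_mat R) (conj_mat H) X"
  using assms
  by (simp add: cric_def ric_def conj_mat_add conj_mat_diff conj_mat_mult conj_transpose_conj_mat
      conj_mat_matrix_inv conj_mat_R_mat)

lemma det_conj_mat_nonzero:
  assumes "det M \<noteq> 0"
  shows "det (conj_mat M) \<noteq> 0"
proof -
  have "conj_mat M ** conj_mat (matrix_inv M) = mat 1"
    by (simp add: matrix_inv_left_right(2)[OF assms] flip: conj_mat_mult)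
  then show ?thesis
    by (metis invertible_det_nz invertible_right_inverse)
qed

lemma cost_0: "cost A B R H W 0 u = hq (gram B R W) u"
  by (simp add: cost_def hq_gram)

text \<open>The transformed input is \<open>(w, v)\<close>, where \<open>w\<close> is the input of the second step and \<open>v\<close> is the
  input of the first step shifted by the gain at \<open>H\<close>; this shift removes the cross terms between
  state and input from the two-step cost.\<close>

lemma transformed_cost:
  fixes A B R H x v
  defines "u \<equiv> v - F_mat A B R H *v x"
  assumes R: "hermitian R" "det R \<noteq> 0" and H: "hermitian H" and RH: "det (R_mat B R H) \<noteq> 0"
  shows "cost (A_hat A B R H) (B_hat A B) (R_hat B R H) (H_hat A B R H) X x (vec_join w v)
    = cost (conj_mat A) (conj_mat B) (conj_mat R) (conj_mat H) X (A *v x + B *v u) w + hq R u + hq H x"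
proof -
  have "F_mat A B R H = gain A B R (conj_mat H)"
    by (simp add: F_mat_def gain_def R_mat_eq_gram)
  then have v: "v = u + gain A B R (conj_mat H) *v x"
    by (simp add: u_def)
  \<comment> \<open>The \<open>conj_mat H\<close> term is the state cost of the second step;
    completing the square there yields the weights \<open>H_hat\<close> and
    \<open>R_mat B R H\<close>.\<close>
  have "hq (conj_mat H) (A *v x + B *v u) + hq R u + hq H x
      = hq (H_hat A B R H) x + hq (R_mat B R H) v"
    using complete_square[of R "conj_mat H" B A H x u] R H RH
    by (simp add: hermitian_conj_mat R_mat_eq_gram H_hat_eq_cric cric_eq_ric cost_def flip: v)
  moreover have "A_hat A B R H *v x + B_hat A B *v vec_join w v
      = conj_mat A *v (A *v x + B *v u) + conj_mat B *v w"
    by (simp add: A_hat_def B_hat_def block_row_mult_vec_join u_def F_mat_def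
        matrix_vector_right_distrib matrix_vector_mult_diff_distrib matrix_vector_mult_diff_rdistrib
        matrix_vector_mul_assoc matrix_mul_assoc)
  ultimately show ?thesis
    by (simp add: cost_def R_hat_def hq_block_diag)
qed

text \<open>Dynamic programming: the square is completed in the later input w first, which leaves a
  one-step cost in u.\<close>

lemma transformed_cost_eq_cric:
  fixes A B R H x v
  defines "u \<equiv> v - F_mat A B R H *v x"
  assumes R: "hermitian R" "det R \<noteq> 0" and H: "hermitian H" and RH: "det (R_mat B R H) \<noteq> 0"
    and X: "hermitian X" "det (R_mat B R X) \<noteq> 0"
  shows "cost (A_hat A B R H) (B_hat A B) (R_hat B R H) (H_hat A B R H) X x (vec_join w v)
    = cost A B R H (conj_mat (cric A B R H X)) x u
      + hq (conj_mat (R_mat B R X))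
          (w + gain (conj_mat A) (conj_mat B) (conj_mat R) X *v (A *v x + B *v u))"
proof -
  have "det (gram (conj_mat B) (conj_mat R) X) \<noteq> 0"
    using det_conj_mat_nonzero[OF X(2)] by (simp add: conj_mat_R_mat)
  then show ?thesis
    unfolding u_def transformed_cost[OF R H RH]
    using complete_square[of "conj_mat R" X "conj_mat B" "conj_mat A" "conj_mat H" _ w] R X
    by (simp add: hermitian_conj_mat conj_mat_cric conj_mat_R_mat) (simp add: cost_def)
qed

context
  fixes A H X :: "complex^'n^'n" and B :: "complex^'m^'n" and R :: "complex^'m^'m"
  assumes R: "hermitian R" "det R \<noteq> 0" and H: "hermitian H" and RH: "det (R_mat B R H) \<noteq> 0"
    and X: "hermitian X"
begin

text \<open>At state 0 a cost is the form of its Gram matrix. The result is a Schur complement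
  decomposition: the shift of w depends only on v.\<close>

lemma hq_R_hat_mat:
  assumes "det (R_mat B R X) \<noteq> 0"
  shows "hq (R_hat_mat A B R H X) (vec_join w v) = hq (R_mat B R (cric A B R H X)) v
    + hq (conj_mat (R_mat B R X)) (w + gain (conj_mat A) (conj_mat B) (conj_mat R) X *v (B *v v))"
  using transformed_cost_eq_cric[OF R H RH X assms, of A 0 w v]
  by (simp add: cost_0 R_hat_mat_eq_gram R_mat_eq_gram[of _ _ "cric A B R H X"])

lemma pos_def_R_hat_mat_iff:
  "pos_def (R_hat_mat A B R H X) \<longleftrightarrow> pos_def (R_mat B R X) \<and> pos_def (R_mat B R (cric A B R H X))"
  (is "?lhs \<longleftrightarrow> ?P \<and> ?Q")
proof
  assume lhs: ?lhs
  \<comment> \<open>The decomposition presupposes that \<open>R_mat B R X\<close> is nonsingular, so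
    positivity is first extracted directly: with v = 0 the first step stays at state 0.\<close>
  have "hq (R_hat_mat A B R H X) (vec_join w 0) = hq (conj_mat (R_mat B R X)) w" for w
    using transformed_cost[OF R H RH, of A X 0 w 0]
    by (simp add: cost_0 R_hat_mat_eq_gram conj_mat_R_mat)
  then have "pos_def (conj_mat (R_mat B R X))"
    using lhs R X unfolding pos_def_iff
    by (metis hermitian_R_mat hermitian_conj_mat vec_join_eq_0_iff)
  then have P: ?P
    using pos_def_conj_mat by fastforce
  \<comment> \<open>This w makes the shifted square vanish.\<close>
  have "hq (R_mat B R (cric A B R H X)) v = hq (R_hat_mat A B R H X)
      (vec_join (- (gain (conj_mat A) (conj_mat B) (conj_mat R) X *v (B *v v))) v)" for v
    by (simp add: hq_R_hat_mat pos_def_det_nonzero[OF P])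
  then have ?Q
    using lhs R(1) hermitian_R_mat[OF R(1) hermitian_cric[OF R(1) H X P]] unfolding pos_def_iff
    by simp
  with P show "?P \<and> ?Q" ..
next
  assume PQ: "?P \<and> ?Q"
  have "hermitian (R_hat_mat A B R H X)"
    by (simp add: R_hat_mat_eq_gram hermitian_gram hermitian_R_hat R H X)
  moreover have "0 < hq (R_hat_mat A B R H X) (vec_join w v)" if "vec_join w v \<noteq> 0" for w v
  proof (cases "v = 0")
    case True
    then show ?thesis
      using that PQ pos_def_conj_mat[of "R_mat B R X"]
      by (simp add: hq_R_hat_mat pos_def_det_nonzero) (simp add: pos_def_iff)
  next
    case False
    then show ?thesis
      using PQ pos_def_hq_nonneg[OF pos_def_conj_mat[of "R_mat B R X"]]
      by (auto simp: hq_R_hat_mat pos_def_det_nonzero pos_def_iff[of "R_mat B R (cric A B R H X)"]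
          intro!: add_pos_nonneg)
  qed
  ultimately show ?lhs
    unfolding pos_def_iff by (metis vec_join_cases)
qed

text \<open>Both sides minimize the same two-step cost, once jointly and once with the later input
  first. Each inequality inserts the optimal inputs of one side into the cost of the other.\<close>

lemma dric_eq_cric_cric:
  assumes P: "pos_def (R_mat B R X)" and Q: "pos_def (R_mat B R (cric A B R H X))"
  shows "dric A B R H X = cric A B R H (cric A B R H X)"
proof (rule hermitian_eqI)
  let ?Y = "cric A B R H X"
  let ?C = "cost (A_hat A B R H) (B_hat A B) (R_hat B R H) (H_hat A B R H) X"
  have Y: "hermitian ?Y"
    by (rule hermitian_cric[OF R(1) H X P])
  have hat: "pos_def (gram (B_hat A B) (R_hat B R H) X)"
    using pos_def_R_hat_mat_iff P Q by (simp add: R_hat_mat_eq_gram)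
  show "hermitian (dric A B R H X)"
    unfolding dric_eq_ric
    by (intro hermitian_ric hermitian_R_hat hermitian_H_hat pos_def_det_nonzero hat R H RH X)
  show "hermitian (cric A B R H ?Y)"
    by (intro hermitian_cric R H Y Q)
  note C = transformed_cost_eq_cric[OF R H RH X pos_def_det_nonzero[OF P], of A]
  show "hq (dric A B R H X) x = hq (cric A B R H ?Y) x" for x
  proof (rule antisym)
    \<comment> \<open>\<open>?u\<close> is optimal for the first step and \<open>?w\<close> is the
      optimal response in the second; adding \<open>F_mat A B R H *v x\<close> below undoes the
      shift of the first input.\<close>
    let ?u = "- (gain A B R (conj_mat ?Y) *v x)"
    let ?w = "- (gain (conj_mat A) (conj_mat B) (conj_mat R) X *v (A *v x + B *v ?u))"
    have "hq (dric A B R H X) x \<le> ?C x (vec_join ?w (?u + F_mat A B R H *v x))"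
      unfolding dric_eq_ric by (intro ric_le_cost hermitian_R_hat R H X hat)
    also have "\<dots> = cost A B R H (conj_mat ?Y) x ?u"
      unfolding C by simp
    also have "\<dots> = hq (cric A B R H ?Y) x"
      using pos_def_det_nonzero[OF Q] R(1) Y
      by (simp add: cric_eq_ric[of _ _ _ _ ?Y] R_mat_eq_gram ric_eq_cost_gain hermitian_conj_mat)
    finally show "hq (dric A B R H X) x \<le> hq (cric A B R H ?Y) x" .
    obtain w v where wv: "- (gain (A_hat A B R H) (B_hat A B) (R_hat B R H) X *v x) = vec_join w v"
      by (rule vec_join_cases)
    have "hq (cric A B R H ?Y) x \<le> cost A B R H (conj_mat ?Y) x (v - F_mat A B R H *v x)"
      by (intro cric_le_cost R Y Q)
    also have "\<dots> \<le> ?C x (vec_join w v)"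
      unfolding C using pos_def_hq_nonneg[OF pos_def_conj_mat[OF P]] by simp
    also have "\<dots> = hq (dric A B R H X) x"
      unfolding dric_eq_ric wv[symmetric]
      by (intro ric_eq_cost_gain[symmetric] hermitian_R_hat R H X pos_def_det_nonzero hat)
    finally show "hq (cric A B R H ?Y) x \<le> hq (dric A B R H X) x" .
  qed
qed

end

theorem theorem3p1:
  fixes A H :: "complex^'n^'n"
    and B :: "complex^'m^'n"
    and R :: "complex^'m^'m"
  assumes R_herm: "hermitian R" and R_nonsing: "det R \<noteq> 0"
    and H_herm: "hermitian H"
    and RH_nonsing: "det (R + conj_transpose B ** conj_mat H ** B) \<noteq> 0"
    and T_nonempty: "T_set A B R \<noteq> {}"
    and RP_nonempty: "R_le_set A B R H \<inter> P_set B R \<noteq> {}"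
  shows "\<exists>X\<^sub>M. maximal_solution (cdare_solutions A B R H) X\<^sub>M
            \<and> maximal_solution (dare_solutions A B R H) X\<^sub>M"
proof -
  have RH: "det (R_mat B R H) \<noteq> 0"
    using RH_nonsing by (simp add: R_mat_def)
  note pd_iff = pos_def_R_hat_mat_iff[OF R_herm R_nonsing H_herm RH]
    and dric = dric_eq_cric_cric[OF R_herm R_nonsing H_herm RH]
  obtain X0 where "hermitian X0" "pos_def (R_mat B R X0)" "X0 \<le>\<^sub>L cric A B R H X0"
    using RP_nonempty by (auto simp: R_le_set_def P_set_def cdom_def)
  then have "sub_pair A B R H X0 X0"
    using R_herm H_herm by (simp add: sub_pair_def loewner_le_iff hermitian_cric)
  then obtain X where X: "X \<in> cdare_solutions A B R H"
    and above: "\<And>Y Z x. sub_pair A B R H Y Z \<Longrightarrow> hq Y x \<le> hq X x"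
    using cdare_solution_above_sub_pairs[OF R_herm H_herm T_nonempty] by metis
  from X have X': "hermitian X" "pos_def (R_mat B R X)" "cric A B R H X = X"
    by (auto simp: cdare_solutions_def P_set_def cdom_def)
  have "Y \<le>\<^sub>L X" if "Y \<in> cdare_solutions A B R H" for Y
  proof -
    have Y: "hermitian Y" "pos_def (R_mat B R Y)" "cric A B R H Y = Y"
      using that by (auto simp: cdare_solutions_def P_set_def cdom_def)
    then have "sub_pair A B R H Y Y"
      by (simp add: sub_pair_def)
    with Y X' show ?thesis
      by (simp add: loewner_le_iff above)
  qed
  \<comment> \<open>Since \<open>cric\<close> fixes X, both positivity conditions coincide, and
    applying \<open>cric\<close> twice also fixes X.\<close>
  moreover have "X \<in> dare_solutions A B R H"
    using X' pd_iff[of X A] dric[of X A]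
    by (simp add: dare_solutions_def P_hat_set_def ddom_def pos_def_det_nonzero)
  moreover have "Y \<le>\<^sub>L X" if "Y \<in> dare_solutions A B R H" for Y
  proof -
    have Y: "hermitian Y" "pos_def (R_hat_mat A B R H Y)" "dric A B R H Y = Y"
      using that by (auto simp: dare_solutions_def P_hat_set_def ddom_def)
    then have pd: "pos_def (R_mat B R Y)" "pos_def (R_mat B R (cric A B R H Y))"
      using pd_iff by blast+
    \<comment> \<open>Y need not be fixed by \<open>cric\<close>, but it has period two, so Y and
      \<open>cric\<close> Y form a pair.\<close>
    then have "cric A B R H (cric A B R H Y) = Y"
      using dric Y by metis
    with Y(1) pd have "sub_pair A B R H Y (cric A B R H Y)"
      by (simp add: sub_pair_def hermitian_cric R_herm H_herm)
    with Y X' show ?thesis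
      by (simp add: loewner_le_iff above)
  qed
  ultimately show ?thesis
    using X by (auto simp: maximal_solution_def)
qed

end
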